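(* If $G$ is a finite group and $\alpha(G) > 3/4$, then $G$ is an elementary abelian $2$-group.
   Context: An involution of a group $G$ means any element $x \in G$ with $x^2 = 1$; by this convention the identity element counts as an involution. For a finite group $G$, $j(G)$ denotes the number of involutions in $G$ (including the identity), and $\alpha(G) = j(G)/|G|$. The trivial group is regarded as an elementary abelian $2$-group. *)

theory Defs
  imports Complex_Main "HOL-Algebra.Multiplicative_Group"
begin

text \<open>The identity counts as an involution.\<close>

definition involutions :: "('a, 'b) monoid_scheme \<Rightarrow> 'a set" where
  "involutions G = {x \<in> carrier G. x [^]\<^bsub>G\<^esub> (2::nat) = \<one>\<^bsub>G\<^esub>}"

definition num_involutions :: "('a, 'b) monoid_scheme \<Rightarrow> nat" where
  "num_involutions G = card (involutions G)"

definition involution_ratio :: "('a, 'b) monoid_scheme \<Rightarrow> real" where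
  "involution_ratio G = real (num_involutions G) / real (order G)"

text \<open>The trivial group qualifies.\<close>

definition elementary_abelian_2_group :: "('a, 'b) monoid_scheme \<Rightarrow> bool" where
  "elementary_abelian_2_group G \<longleftrightarrow>
     comm_group G \<and> (\<forall>x \<in> carrier G. x \<noteq> \<one>\<^bsub>G\<^esub> \<longrightarrow> group.ord G x = 2)"

end

theory Submission
  imports Defs
begin

text \<open>
  Write \<open>J\<close> for the set of involutions. The argument uses twice that a subgroup with more than
  half of the elements of a finite group is the whole group (\<open>large_subgroup_eq_carrier\<close>).

  Fix \<open>x \<in> J\<close>. The sets \<open>J\<close> and \<open>x J\<close> each contain more than three quarters of \<open>G\<close>, so they
  share more than half of it. If \<open>y\<close> lies in both, then \<open>y\<close> and \<open>x y\<close> are involutions along with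
  \<open>x\<close>, which forces \<open>x\<close> and \<open>y\<close> to commute. The centralizer of \<open>x\<close> is therefore all of \<open>G\<close>:
  involutions are central (\<open>involution_central\<close>). Commuting involutions have an involution as
  product, so \<open>J\<close> is a subgroup, and by its size it is \<open>G\<close>. Thus every element of \<open>G\<close> is a
  central involution.
\<close>

context group
begin

lemma involutions_iff: "x \<in> involutions G \<longleftrightarrow> x \<in> carrier G \<and> x \<otimes> x = \<one>"
  by (auto simp: involutions_def numeral_2_eq_2)

text \<open>By Lagrange's theorem the index of such a subgroup is less than two.\<close>

lemma large_subgroup_eq_carrier:
  assumes fin: "finite (carrier G)" and H: "subgroup H G" and large: "order G < 2 * card H"
  shows "H = carrier G"
proof -
  have lag: "card (rcosets H) * card H = order G"
    using H by (rule lagrange)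
  have "order G > 0"
    using fin order_gt_0_iff_finite by blast
  with lag have "card (rcosets H) \<noteq> 0"
    by (metis mult_0 less_irrefl)
  moreover have "card (rcosets H) < 2"
    using lag large by (metis mult_less_cancel2)
  ultimately have "card (rcosets H) = 1"
    by linarith
  with lag have "card H = card (carrier G)"
    by (simp add: order_def)
  with fin H show ?thesis
    by (simp add: card_subset_eq subgroup.subset)
qed

lemma subgroup_centralizer:
  assumes x: "x \<in> carrier G"
  shows "subgroup {y \<in> carrier G. x \<otimes> y = y \<otimes> x} G"
proof (rule subgroupI)
  show "{y \<in> carrier G. x \<otimes> y = y \<otimes> x} \<noteq> {}"
    using x by auto
next
  fix y assume "y \<in> {y \<in> carrier G. x \<otimes> y = y \<otimes> x}"
  then have y: "y \<in> carrier G" "x \<otimes> y = y \<otimes> x"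
    by auto
  have "inv y \<otimes> x = inv y \<otimes> (x \<otimes> y) \<otimes> inv y"
    using x y(1) by (simp add: m_assoc)
  also have "\<dots> = (inv y \<otimes> y) \<otimes> x \<otimes> inv y"
    unfolding y(2) using x y(1) by (simp only: m_assoc inv_closed m_closed)
  also have "\<dots> = x \<otimes> inv y"
    using x y(1) by simp
  finally have "x \<otimes> inv y = inv y \<otimes> x"
    by simp
  with y(1) show "inv y \<in> {y \<in> carrier G. x \<otimes> y = y \<otimes> x}"
    by simp
next
  fix y z
  assume "y \<in> {y \<in> carrier G. x \<otimes> y = y \<otimes> x}" "z \<in> {y \<in> carrier G. x \<otimes> y = y \<otimes> x}"
  with x show "y \<otimes> z \<in> {y \<in> carrier G. x \<otimes> y = y \<otimes> x}"
    by (auto simp flip: m_assoc) (simp add: m_assoc)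
qed auto

text \<open>An involution is its own inverse, so \<open>x y = (x y)\<^sup>-\<^sup>1 = y\<^sup>-\<^sup>1 x\<^sup>-\<^sup>1 = y x\<close>.\<close>

lemma involutions_commute:
  assumes "x \<in> involutions G" "y \<in> involutions G" "x \<otimes> y \<in> involutions G"
  shows "x \<otimes> y = y \<otimes> x"
proof -
  have self_inv: "inv z = z" if "z \<in> involutions G" for z
    using that inv_equality by (auto simp: involutions_iff)
  have "x \<otimes> y = inv (x \<otimes> y)"
    using self_inv[OF assms(3)] by simp
  also have "\<dots> = inv y \<otimes> inv x"
    using assms by (intro inv_mult_group) (auto simp: involutions_iff)
  finally show ?thesis
    using assms self_inv by simp
qed

lemma involution_central:
  assumes fin: "finite (carrier G)"
    and many: "3 * order G < 4 * card (involutions G)"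
    and x: "x \<in> involutions G" and y: "y \<in> carrier G"
  shows "x \<otimes> y = y \<otimes> x"
proof -
  define J where "J = involutions G"
  define C where "C = {y \<in> carrier G. x \<otimes> y = y \<otimes> x}"
  have xG: "x \<in> carrier G" and xx: "x \<otimes> x = \<one>"
    using x by (auto simp: involutions_iff)
  have J: "J \<subseteq> carrier G" "finite J"
    using fin by (auto simp: J_def involutions_def)
  have xJ: "(\<otimes>) x ` J \<subseteq> carrier G" "finite ((\<otimes>) x ` J)"
    using J xG by auto
  have "inj_on ((\<otimes>) x) J"
    using inj_on_cmult[OF xG] J(1) by (rule inj_on_subset)
  then have card_xJ: "card ((\<otimes>) x ` J) = card J"
    by (rule card_image)
  have "card (J \<union> (\<otimes>) x ` J) \<le> order G"
    unfolding order_def using J xJ fin by (intro card_mono) auto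
  then have overlap: "2 * card J \<le> order G + card (J \<inter> (\<otimes>) x ` J)"
    using card_Un_Int[OF J(2) xJ(2)] card_xJ by linarith
  have "J \<inter> (\<otimes>) x ` J \<subseteq> C"
  proof
    fix z assume z: "z \<in> J \<inter> (\<otimes>) x ` J"
    then obtain w where w: "w \<in> J" "z = x \<otimes> w"
      by blast
    have "x \<otimes> z = w"
      using w J xG xx by (auto simp flip: m_assoc)
    with z w x have "x \<otimes> z = z \<otimes> x"
      by (intro involutions_commute) (auto simp: J_def)
    with z J show "z \<in> C"
      by (auto simp: C_def)
  qed
  then have "card (J \<inter> (\<otimes>) x ` J) \<le> card C"
    using fin by (intro card_mono) (auto simp: C_def)
  with overlap many have "order G < 2 * card C"
    unfolding J_def by linarith
  moreover have "subgroup C G"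
    unfolding C_def using xG by (rule subgroup_centralizer)
  ultimately have "C = carrier G"
    using large_subgroup_eq_carrier[OF fin] by blast
  with y show ?thesis
    by (auto simp: C_def)
qed

lemma subgroup_involutions:
  assumes comm: "\<And>x y. \<lbrakk>x \<in> involutions G; y \<in> involutions G\<rbrakk> \<Longrightarrow> x \<otimes> y = y \<otimes> x"
  shows "subgroup (involutions G) G"
proof (rule subgroupI)
  show "involutions G \<subseteq> carrier G"
    by (auto simp: involutions_iff)
  have "\<one> \<in> involutions G"
    by (simp add: involutions_iff)
  then show "involutions G \<noteq> {}"
    by blast
next
  fix x assume "x \<in> involutions G"
  then show "inv x \<in> involutions G"
    by (metis involutions_iff inv_equality)
next
  fix x y assume x: "x \<in> involutions G" and y: "y \<in> involutions G"
  then have G: "x \<in> carrier G" "y \<in> carrier G" and sq: "x \<otimes> x = \<one>" "y \<otimes> y = \<one>"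
    by (auto simp: involutions_iff)
  have "(x \<otimes> y) \<otimes> (x \<otimes> y) = (x \<otimes> y) \<otimes> (y \<otimes> x)"
    using comm[OF x y] by simp
  also have "\<dots> = x \<otimes> (y \<otimes> y) \<otimes> x"
    using G by (simp add: m_assoc)
  also have "\<dots> = \<one>"
    using G sq by simp
  finally show "x \<otimes> y \<in> involutions G"
    using G by (simp add: involutions_iff)
qed

end

theorem theorem4p1:
  fixes G :: "('a, 'b) monoid_scheme"
  assumes "group G" and "finite (carrier G)"
    and "involution_ratio G > 3 / 4"
  shows "elementary_abelian_2_group G"
proof -
  interpret group G by fact
  have "order G > 0"
    using assms(2) order_gt_0_iff_finite by blast
  then have "3 * real (order G) < 4 * real (card (involutions G))"
    using assms(3) by (simp add: involution_ratio_def num_involutions_def field_simps)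
  then have many: "3 * order G < 4 * card (involutions G)"
    by linarith
  note central = involution_central[OF assms(2) many]
  have "subgroup (involutions G) G"
  proof (rule subgroup_involutions)
    fix x y assume "x \<in> involutions G" "y \<in> involutions G"
    then show "x \<otimes>\<^bsub>G\<^esub> y = y \<otimes>\<^bsub>G\<^esub> x"
      using central involutions_iff by blast
  qed
  then have all: "involutions G = carrier G"
    by (rule large_subgroup_eq_carrier[OF assms(2)]) (use many in linarith)
  have "comm_group G"
    using central unfolding all by (rule group_comm_groupI)
  moreover have "ord x = 2" if x: "x \<in> carrier G" "x \<noteq> \<one>\<^bsub>G\<^esub>" for x
  proof -
    have "x [^]\<^bsub>G\<^esub> (2::nat) = \<one>\<^bsub>G\<^esub>"
      using x(1) unfolding all[symmetric] by (simp add: involutions_def)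
    then have "ord x dvd 2"
      using x pow_eq_id by blast
    then have "ord x \<noteq> 0" "ord x \<le> 2"
      by (auto dest: dvd_imp_le intro!: Nat.gr0I)
    then have "ord x = 1 \<or> ord x = 2"
      by linarith
    with x show ?thesis
      using ord_eq_1 by blast
  qed
  ultimately show ?thesis
    by (auto simp: elementary_abelian_2_group_def)
qed

end
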